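(* Let $(X,\mathcal{B},\mu,T)$ be an ergodic measure theoretical dynamical system and let $\mathcal{U}$ be a cover of $X$. Then $h_\mu^+(\mathcal{U})=h_\mu^-(\mathcal{U})$.
   Context: A measure theoretical dynamical system is a four-tuple $(X,\mathcal{B},\mu,T)$, where $(X,\mathcal{B})$ is a standard space (i.e. isomorphic to $[0,1]$ with the Borel $\sigma$-algebra), $\mu$ is a probability measure on $(X,\mathcal{B})$ and $T$ is an invertible measure preserving transformation of $X$. A cover of $X$ is a finite collection of measurable sets whose union is $X$; a partition is a cover whose elements are mutually disjoint. A cover $\mathcal{U}$ is finer than a cover $\mathcal{V}$, written $\mathcal{U}\succeq\mathcal{V}$, if every element of $\mathcal{U}$ is contained in an element of $\mathcal{V}$. The join $\mathcal{U}\vee\mathcal{V}$ is the cover whose elements are the sets $U\cap V$ with $U\in\mathcal{U}$, $V\in\mathcal{V}$; $T^k(\mathcal{U})$ is the cover with elements $T^k(U)$, $U\in\mathcal{U}$; and $\mathcal{U}_0^{n-1}=\mathcal{U}\vee T^{-1}(\mathcal{U})\vee\dots\vee T^{-(n-1)}(\mathcal{U})$. For a partition $\alpha$, $H_\mu(\alpha)=-\sum_{A\in\alpha}\mu(A)\log\mu(A)$, and $h_\mu(\alpha)=\lim_{n}\frac1n H_\mu(\alpha_0^{n-1})$ is the usual measure theoretical entropy of $\alpha$ with respect to $T$. For a cover $\mathcal{V}$, $H_\mu(\mathcal{V})=\inf\{H_\mu(\alpha):\alpha\text{ a partition of }X,\ \alpha\succeq\mathcal{V}\}$. For a cover $\mathcal{U}$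 define $$h_\mu^+(\mathcal{U})=\inf\{h_\mu(\alpha) : \alpha \text{ a partition of } X,\ \alpha\succeq\mathcal{U}\},\qquad h_\mu^-(\mathcal{U})=\lim_{n\to\infty}\frac1n H_\mu(\mathcal{U}_0^{n-1}),$$ the last limit existing because the sequence $H_\mu(\mathcal{U}_0^{n-1})$ is sub-additive. *)

theory Defs
  imports "HOL-Probability.Probability"
begin

definition measurable_isomorphic :: "'a measure \<Rightarrow> 'b measure \<Rightarrow> bool" where
  "measurable_isomorphic M N \<longleftrightarrow>
     (\<exists>f g. f \<in> measurable M N \<and> g \<in> measurable N M \<and>
        (\<forall>x\<in>space M. g (f x) = x) \<and> (\<forall>y\<in>space N. f (g y) = y))"

text \<open>Only the measurable structure of the measure matters here.  The space is literally
  required to be isomorphic to the unit interval, so countable spaces are excluded.\<close>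
definition standard_space :: "'a measure \<Rightarrow> bool" where
  "standard_space M \<longleftrightarrow> measurable_isomorphic M (restrict_space borel {0..1::real})"

locale dynamical_system = prob_space M for M :: "'a measure" and T :: "'a \<Rightarrow> 'a" +
  assumes standard: "standard_space M"
    and bij: "bij_betw T (space M) (space M)"
    and meas: "T \<in> measurable M M"
    and meas_inv: "inv_into (space M) T \<in> measurable M M"
    and preserving: "distr M M T = M"

locale ergodic_system = dynamical_system M T for M :: "'a measure" and T :: "'a \<Rightarrow> 'a" +
  assumes ergodic:
    "\<And>A. A \<in> sets M \<Longrightarrow> T -` A \<inter> space M = A \<Longrightarrow> measure M A = 0 \<or> measure M A = 1"

definition is_cover :: "'a measure \<Rightarrow> 'a set set \<Rightarrow> bool" where
  "is_cover M \<U> \<longleftrightarrow> finite \<U> \<and> \<U> \<subseteq> sets M \<and> \<Union>\<U> = space M"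

text \<open>Unlike in \<open>partition_on\<close>, the empty set may be an element of a partition.\<close>
definition is_partition :: "'a measure \<Rightarrow> 'a set set \<Rightarrow> bool" where
  "is_partition M \<alpha> \<longleftrightarrow> is_cover M \<alpha> \<and> disjoint \<alpha>"

definition finer :: "'a set set \<Rightarrow> 'a set set \<Rightarrow> bool" where
  "finer \<U> \<V> \<longleftrightarrow> (\<forall>U\<in>\<U>. \<exists>V\<in>\<V>. U \<subseteq> V)"

definition cover_join :: "'a set set \<Rightarrow> 'a set set \<Rightarrow> 'a set set" where
  "cover_join \<U> \<V> = {U \<inter> V | U V. U \<in> \<U> \<and> V \<in> \<V>}"

text \<open>The cover \<open>T\<^sup>-\<^sup>k(\<U>)\<close>.\<close>
definition cover_preimage :: "'a measure \<Rightarrow> ('a \<Rightarrow> 'a) \<Rightarrow> nat \<Rightarrow> 'a set set \<Rightarrow> 'a set set" where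
  "cover_preimage M T k \<U> = (\<lambda>U. (T ^^ k) -` U \<inter> space M) ` \<U>"

text \<open>\<open>iterated_join M T \<U> n\<close> is \<open>\<U> \<or> T\<^sup>-\<^sup>1(\<U>) \<or> \<dots> \<or> T\<^sup>-\<^sup>(\<^sup>n\<^sup>-\<^sup>1\<^sup>)(\<U>)\<close>, a join of \<open>n\<close> covers;
  the trivial cover \<open>{X}\<close> is the empty join.\<close>
primrec iterated_join :: "'a measure \<Rightarrow> ('a \<Rightarrow> 'a) \<Rightarrow> 'a set set \<Rightarrow> nat \<Rightarrow> 'a set set" where
  "iterated_join M T \<U> 0 = {space M}"
| "iterated_join M T \<U> (Suc n) = cover_join (iterated_join M T \<U> n) (cover_preimage M T n \<U>)"

text \<open>The convention \<open>0 log 0 = 0\<close> holds automatically.\<close>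
definition partition_entropy :: "'a measure \<Rightarrow> 'a set set \<Rightarrow> real" where
  "partition_entropy M \<alpha> = - (\<Sum>A\<in>\<alpha>. measure M A * ln (measure M A))"

definition cover_entropy :: "'a measure \<Rightarrow> 'a set set \<Rightarrow> real" where
  "cover_entropy M \<V> = Inf {partition_entropy M \<alpha> | \<alpha>. is_partition M \<alpha> \<and> finer \<alpha> \<V>}"

definition dynamical_entropy :: "'a measure \<Rightarrow> ('a \<Rightarrow> 'a) \<Rightarrow> 'a set set \<Rightarrow> real" where
  "dynamical_entropy M T \<alpha> = lim (\<lambda>n. partition_entropy M (iterated_join M T \<alpha> n) / real n)"

definition h_plus :: "'a measure \<Rightarrow> ('a \<Rightarrow> 'a) \<Rightarrow> 'a set set \<Rightarrow> real" where
  "h_plus M T \<U> = Inf {dynamical_entropy M T \<alpha> | \<alpha>. is_partition M \<alpha> \<and> finer \<alpha> \<U>}"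

definition h_minus :: "'a measure \<Rightarrow> ('a \<Rightarrow> 'a) \<Rightarrow> 'a set set \<Rightarrow> real" where
  "h_minus M T \<U> = lim (\<lambda>n. cover_entropy M (iterated_join M T \<U> n) / real n)"

end

theory Submission
  imports Defs "HOL-Real_Asymp.Real_Asymp"
begin

text \<open>Why the two entropies agree.  If a partition \<open>\<alpha>\<close> refines \<open>\<U>\<close>, then its iterated joins refine
  those of \<open>\<U>\<close>, so the averages defining \<open>h_minus\<close> are bounded by those of \<open>\<alpha>\<close>, and
  \<open>h_minus \<le> h_plus\<close>.  The converse is a coding argument: for every \<open>n > 0\<close> and every partition \<open>\<alpha>\<close>
  finer than the \<open>n\<close>-fold join of \<open>\<U>\<close>,
  \<^item> \<open>h_plus M T \<U> \<le> (partition_entropy M \<alpha> + ln n + 1) / n\<close>.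

  To see this, cut almost every orbit into blocks of length \<open>n\<close>, marking the point at which a block
  starts.  The cell of \<open>\<alpha>\<close> containing the starting point names, for each of the \<open>n\<close> points of
  the block, an element of \<open>\<U>\<close> that contains it.  Choosing these elements gives
  a partition finer than \<open>\<U>\<close> that can be computed from a process which shows the cell of \<open>\<alpha>\<close> at the marked
  points and nothing elsewhere.  The marked points have density about \<open>1 / n\<close>, so the entropy of this process
  should be about \<open>1 / n\<close> times that of \<open>\<alpha>\<close>.

  The marked points come from a clock, a function \<open>J\<close> into \<open>{..<n}\<close> that ticks down by one modulo
  \<open>n\<close> along orbits except on a set of small measure (\<open>exists_clock\<close>): it is the time needed
  to hit a small set, reduced modulo \<open>n\<close>, and ergodicity makes this time finite almost everywhere.
  For a single prescribed set of marked points the process could be too rich, since the marks might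
  sit where \<open>\<alpha>\<close> is most complicated.  But each of the \<open>n\<close> values of the clock can serve as the mark, the \<open>n\<close>
  resulting entropies add up to at most the joint entropy of \<open>\<alpha>\<close> and \<open>J\<close> plus one, and so some value does
  at least as well as the average (\<open>exists_marker_small_entropy\<close>).  The points that belong to no block have
  small measure, and describing them separately costs arbitrarily little entropy.

  A clock requires sets of arbitrarily small positive measure.  If there are none, the entropies of all partitions
  have a common bound, so dynamical entropies vanish and the inequality is trivial.

  Letting \<open>n\<close> tend to infinity, the coding inequality bounds the averages of \<open>h_minus\<close> from below by
  \<open>h_plus\<close> up to \<open>(ln n + 1) / n\<close>.  The two bounds together also give the convergence of these averages; for
  the averages of a single partition, convergence is Fekete's lemma.\<close>

section \<open>Averages of subadditive sequences\<close>

text \<open>Fekete's lemma: dividing \<open>m\<close> by \<open>n\<close> with remainder gives \<open>a m / m \<le> a n / n + C / m\<close>, so the limit is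
  the infimum of the averages.\<close>
lemma subadditive_imp_convergent_average:
  fixes a :: "nat \<Rightarrow> real"
  assumes nonneg: "\<And>n. 0 \<le> a n" and sub: "\<And>m n. a (m + n) \<le> a m + a n"
  shows "convergent (\<lambda>n. a n / real n)"
proof -
  define L where "L = Inf ((\<lambda>n. a n / real n) ` {1..})"
  have bdd: "bdd_below ((\<lambda>n. a n / real n) ` {1..})"
    by (rule bdd_belowI[of _ 0]) (auto simp: nonneg)
  have lower: "L \<le> a n / real n" if "n \<ge> 1" for n
    unfolding L_def by (rule cInf_lower[OF _ bdd]) (use that in auto)
  have mult: "a (q * n) \<le> real q * a n + a 0" for q n
  proof (induction q)
    case (Suc q)
    show ?case using sub[of n "q * n"] Suc by (simp add: algebra_simps)
  qed simp
  have "(\<lambda>n. a n / real n) \<longlonglongrightarrow> L"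
  proof (rule order_tendstoI)
    fix y assume "y < L"
    then show "\<forall>\<^sub>F n in sequentially. y < a n / real n"
      using lower by (intro eventually_sequentiallyI[of 1]) (metis less_le_trans)
  next
    fix y assume "L < y"
    then obtain n where n: "n \<ge> 1" "a n / real n < y"
      unfolding L_def using cInf_lessD[of "(\<lambda>n. a n / real n) ` {1..}" y] by auto
    (* C absorbs the remainder a (m mod n) and the term a 0 from the empty multiple. *)
    define C where "C = a 0 + (\<Sum>r<n. a r)"
    have bound: "a m / real m \<le> a n / real n + C / real m" if m: "m \<ge> 1" for m
    proof -
      have "a m \<le> a (m div n * n) + a (m mod n)"
        using sub[of "m div n * n" "m mod n"] by simp
      also have "a (m mod n) \<le> (\<Sum>r<n. a r)"
        using n nonneg by (intro member_le_sum) auto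
      finally have "a m \<le> real (m div n) * a n + C"
        using mult[of "m div n" n] by (simp add: C_def)
      moreover have "real (m div n) * a n \<le> real m / real n * a n"
        by (intro mult_right_mono nonneg of_nat_div_le_of_nat)
      ultimately have "a m \<le> real m / real n * a n + C" by linarith
      then have "a m / real m \<le> (real m / real n * a n + C) / real m"
        by (intro divide_right_mono) auto
      also have "\<dots> = a n / real n + C / real m"
        using m n by (simp add: field_simps)
      finally show ?thesis .
    qed
    have "(\<lambda>m. a n / real n + C / real m) \<longlonglongrightarrow> a n / real n + 0"
      by (intro tendsto_add tendsto_const lim_const_over_n)
    then have "\<forall>\<^sub>F m in sequentially. a n / real n + C / real m < y"
      using n by (intro order_tendstoD) auto
    then show "\<forall>\<^sub>F m in sequentially. a m / real m < y"
      using eventually_ge_at_top[of 1]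
      by eventually_elim (use bound in fastforce)
  qed
  then show ?thesis by (auto simp: convergent_def)
qed

section \<open>Entropy of finite-valued functions\<close>

definition neg_xlnx :: "real \<Rightarrow> real" where
  "neg_xlnx p = - (p * ln p)"

lemma neg_xlnx_0 [simp]: "neg_xlnx 0 = 0"
  by (simp add: neg_xlnx_def)

lemma neg_xlnx_nonneg: "0 \<le> p \<Longrightarrow> p \<le> 1 \<Longrightarrow> 0 \<le> neg_xlnx p"
  by (cases "p = 0") (auto simp: neg_xlnx_def mult_nonneg_nonpos)

lemma neg_xlnx_le_one_minus: assumes "0 \<le> p" shows "neg_xlnx p \<le> 1 - p"
proof (cases "p = 0")
  case False
  then have p: "p > 0" using assms by simp
  have "- ln p \<le> 1 / p - 1"
    using ln_le_minus_one[of "1 / p"] p by (simp add: ln_div)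
  then have "p * - ln p \<le> p * (1 / p - 1)" using p by (intro mult_left_mono) auto
  then show ?thesis using p by (simp add: neg_xlnx_def algebra_simps)
qed simp

text \<open>A modulus of continuity at \<open>0\<close>: with \<open>p = s\<^sup>2\<close> one has \<open>- p ln p = 2 s (- s ln s)\<close>, and
  \<open>- s ln s \<le> 1\<close>.\<close>
lemma neg_xlnx_le_sqrt: assumes "0 \<le> p" shows "neg_xlnx p \<le> 2 * sqrt p"
proof (cases "p = 0")
  case False
  define s where "s = sqrt p"
  have s: "s > 0" "p = s * s" using False assms by (auto simp: s_def)
  have "neg_xlnx p = 2 * s * neg_xlnx s" using s by (simp add: neg_xlnx_def ln_mult)
  also have "\<dots> \<le> 2 * s * 1"
    using neg_xlnx_le_one_minus[of s] s by (intro mult_left_mono) auto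
  finally show ?thesis by (simp add: s_def)
qed simp

text \<open>With the hypothesis stated on fibres, the factor map need not be exhibited when functions are shown to
  determine each other.\<close>
lemma simple_function_determined:
  assumes X: "simple_function M X"
    and det: "\<And>x y. x \<in> space M \<Longrightarrow> y \<in> space M \<Longrightarrow> X x = X y \<Longrightarrow> Y x = Y y"
  obtains f where "\<And>x. x \<in> space M \<Longrightarrow> Y x = f (X x)" and "simple_function M Y"
proof -
  define f where "f v = Y (SOME x. x \<in> space M \<and> X x = v)" for v
  have eq: "Y x = f (X x)" if "x \<in> space M" for x
  proof -
    have "(SOME z. z \<in> space M \<and> X z = X x) \<in> space M \<and> X (SOME z. z \<in> space M \<and> X z = X x) = X x"
      by (rule someI[of _ x]) (use that in auto)
    then show ?thesis unfolding f_def using det that by metis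
  qed
  have "simple_function M Y"
    using simple_function_compose1[OF X, of f] by (subst simple_function_cong) (auto simp: eq)
  then show thesis using that eq by blast
qed

context information_space
begin

lemma entropy_simple_function:
  assumes "simple_function M X"
  shows "\<H>(X) = - (\<Sum>y\<in>X ` space M. prob (X -` {y} \<inter> space M) * log b (prob (X -` {y} \<inter> space M)))"
  by (rule entropy_simple_distributed[OF simple_distributedI[OF assms measure_nonneg refl]])

lemma entropy_simple_cong:
  assumes X: "simple_function M X" and eq: "\<And>x. x \<in> space M \<Longrightarrow> X x = Y x"
  shows "\<H>(X) = \<H>(Y)"
proof -
  have Y: "simple_function M Y" using X eq by (subst simple_function_cong[of _ _ X]) auto
  have "X -` {y} \<inter> space M = Y -` {y} \<inter> space M" for y using eq by auto
  moreover have "X ` space M = Y ` space M" using eq by (auto simp: image_iff)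
  ultimately show ?thesis
    unfolding entropy_simple_function[OF X] entropy_simple_function[OF Y] by simp
qed

lemma entropy_le_of_determines:
  assumes X: "simple_function M X"
    and det: "\<And>x y. x \<in> space M \<Longrightarrow> y \<in> space M \<Longrightarrow> X x = X y \<Longrightarrow> Y x = Y y"
  shows "\<H>(Y) \<le> \<H>(X)"
proof -
  obtain f where f: "\<And>x. x \<in> space M \<Longrightarrow> Y x = f (X x)" and Y: "simple_function M Y"
    using simple_function_determined[of M X Y] assms by metis
  have "\<H>(Y) = \<H>(f \<circ> X)" by (rule entropy_simple_cong[OF Y]) (simp add: f)
  then show ?thesis using entropy_data_processing[OF X, of f] by simp
qed

lemma entropy_le_add_of_determines:
  assumes X: "simple_function M X" and Y: "simple_function M Y"
    and det: "\<And>x y. x \<in> space M \<Longrightarrow> y \<in> space M \<Longrightarrow> X x = X y \<Longrightarrow> Y x = Y y \<Longrightarrow> Z x = Z y"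
  shows "\<H>(Z) \<le> \<H>(X) + \<H>(Y)"
proof -
  have "\<H>(Z) \<le> \<H>(\<lambda>x. (X x, Y x))"
  proof (rule entropy_le_of_determines[OF simple_function_Pair[OF X Y]])
    fix x y assume "x \<in> space M" "y \<in> space M" "(X x, Y x) = (X y, Y y)"
    then show "Z x = Z y" by (intro det) simp_all
  qed
  also have "\<dots> \<le> \<H>(X) + \<H>(Y)"
    using entropy_chain_rule[OF X Y] conditional_entropy_less_eq_entropy[OF Y X] by simp
  finally show ?thesis .
qed

end

text \<open>
  Entropy with natural logarithms, as in \<open>partition_entropy\<close>.  It is attached to finite-valued
  maps rather than to partitions: joins then become pairs, and refinement becomes determination of one
  map by another.
\<close>
abbreviation (in prob_space) Ent :: "('a \<Rightarrow> 'b) \<Rightarrow> real" where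
  "Ent X \<equiv> entropy (exp 1) (count_space (X ` space M)) X"

text \<open>The map \<open>X\<close> as seen by an observer who looks only at times when the point lies in \<open>Q\<close>.\<close>
definition mark :: "'a set \<Rightarrow> ('a \<Rightarrow> 'b) \<Rightarrow> 'a \<Rightarrow> 'b option" where
  "mark Q X x = (if x \<in> Q then Some (X x) else None)"

context prob_space
begin

interpretation information_space M "exp 1"
  by unfold_locales simp

lemma entropy_eq_sum:
  assumes X: "simple_function M X" and F: "finite F" "X ` space M \<subseteq> F"
  shows "Ent X = (\<Sum>y\<in>F. neg_xlnx (prob (X -` {y} \<inter> space M)))"
proof -
  have "Ent X = (\<Sum>y\<in>X ` space M. neg_xlnx (prob (X -` {y} \<inter> space M)))"
    by (simp add: entropy_simple_function[OF X] neg_xlnx_def log_def sum_negf)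
  also have "\<dots> = (\<Sum>y\<in>F. neg_xlnx (prob (X -` {y} \<inter> space M)))"
  proof (rule sum.mono_neutral_left[OF F], rule ballI)
    fix y assume "y \<in> F - X ` space M"
    then have "X -` {y} \<inter> space M = {}" by auto
    then show "neg_xlnx (prob (X -` {y} \<inter> space M)) = 0" by simp
  qed
  finally show ?thesis .
qed

lemma entropy_nonneg:
  assumes X: "simple_function M X" shows "0 \<le> Ent X"
  unfolding entropy_eq_sum[OF X simple_functionD(1)[OF X] subset_refl]
  by (intro sum_nonneg neg_xlnx_nonneg) auto

lemma sum_prob_fibres:
  assumes X: "simple_function M X"
  shows "(\<Sum>y\<in>X ` space M. prob (X -` {y} \<inter> space M)) = 1"
  by (rule simple_distributed_sum_space[OF simple_distributedI[OF X measure_nonneg refl]])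

text \<open>The symbol \<open>None\<close> has probability \<open>1 - prob Q\<close> and contributes at most \<open>prob Q\<close>, by
  \<open>neg_xlnx_le_one_minus\<close>.\<close>
lemma entropy_mark_le:
  assumes X: "simple_function M X" and F: "finite F" "X ` space M \<subseteq> F" and Q: "Q \<in> sets M"
  shows "simple_function M (mark Q X)"
    and "Ent (mark Q X) \<le>
      prob Q + (\<Sum>a\<in>F. neg_xlnx (prob (Q \<inter> X -` {a})))"
proof -
  let ?m = "mark Q X"
  show m: "simple_function M ?m"
    unfolding mark_def[abs_def] using Q sets.sets_into_space[OF Q]
    by (intro simple_function_If_set simple_function_compose1[OF X] simple_function_const) (auto simp: Int_absorb2)
  have Qs: "Q \<subseteq> space M" using Q sets.sets_into_space by blast
  have "Ent ?m = (\<Sum>y\<in>insert None (Some ` F). neg_xlnx (prob (?m -` {y} \<inter> space M)))"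
    by (rule entropy_eq_sum[OF m]) (use F in \<open>auto simp: mark_def\<close>)
  also have "\<dots> = neg_xlnx (prob (?m -` {None} \<inter> space M)) + (\<Sum>a\<in>F. neg_xlnx (prob (?m -` {Some a} \<inter> space M)))"
    using F by (subst sum.insert) (auto simp: sum.reindex)
  also have "?m -` {None} \<inter> space M = space M - Q" by (auto simp: mark_def)
  also have "neg_xlnx (prob (space M - Q)) \<le> prob Q"
    using neg_xlnx_le_one_minus[of "prob (space M - Q)"] prob_compl[OF Q] by simp
  also have "(\<Sum>a\<in>F. neg_xlnx (prob (?m -` {Some a} \<inter> space M))) = (\<Sum>a\<in>F. neg_xlnx (prob (Q \<inter> X -` {a})))"
  proof (rule sum.cong[OF refl])
    fix a
    have "?m -` {Some a} \<inter> space M = Q \<inter> X -` {a}" using Qs by (auto simp: mark_def split: if_splits)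
    then show "neg_xlnx (prob (?m -` {Some a} \<inter> space M)) = neg_xlnx (prob (Q \<inter> X -` {a}))" by simp
  qed
  finally show "Ent ?m \<le> prob Q + (\<Sum>a\<in>F. neg_xlnx (prob (Q \<inter> X -` {a})))" by simp
qed

text \<open>An averaging argument.  Summed over \<open>j\<close>, the bounds of \<open>entropy_mark_le\<close> give \<open>1\<close> plus the entropy
  of the pair \<open>(J, X)\<close>, which is at most \<open>ln n + Ent X\<close>.  Hence some \<open>j\<close> marks a set on which \<open>X\<close> can be
  observed at the price of about one \<open>n\<close>-th of its entropy.\<close>
lemma exists_marker_small_entropy:
  fixes n :: nat and J :: "'a \<Rightarrow> nat"
  assumes X: "simple_function M X" and J: "simple_function M J"
    and n: "n > 0" and J_less: "J ` space M \<subseteq> {..<n}"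
  shows "\<exists>j<n. Ent (mark (J -` {j} \<inter> space M) X) \<le> (Ent X + ln n + 1) / n"
proof (rule ccontr)
  let ?Q = "\<lambda>j. J -` {j} \<inter> space M"
  let ?h = "\<lambda>j. Ent (mark (?Q j) X)"
  let ?F = "X ` space M"
  assume "\<not> ?thesis"
  then have "(Ent X + ln n + 1) / n < ?h j" if "j < n" for j using that by (meson not_le)
  then have less: "(Ent X + ln n + 1) / n < ?h j" if "j \<in> {..<n}" for j using that by blast
  have "(\<Sum>j<n. (Ent X + ln n + 1) / n) < (\<Sum>j<n. ?h j)"
    by (rule sum_strict_mono[OF _ _ less]) (use n in auto)
  also have "\<dots> \<le> (\<Sum>j<n. prob (?Q j) + (\<Sum>a\<in>?F. neg_xlnx (prob (?Q j \<inter> X -` {a}))))"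
    using entropy_mark_le(2)[OF X simple_functionD(1)[OF X] subset_refl] simple_functionD(2)[OF J]
    by (intro sum_mono) blast
  also have "\<dots> = (\<Sum>j<n. prob (?Q j)) + (\<Sum>j<n. \<Sum>a\<in>?F. neg_xlnx (prob (?Q j \<inter> X -` {a})))"
    by (simp add: sum.distrib)
  also have "(\<Sum>j<n. prob (?Q j)) = (\<Sum>j\<in>J ` space M. prob (?Q j))"
  proof (rule sum.mono_neutral_right[OF _ J_less], simp, rule ballI)
    fix j assume "j \<in> {..<n} - J ` space M"
    then have "?Q j = {}" by auto
    then show "prob (?Q j) = 0" by simp
  qed
  also have "\<dots> = 1" by (rule sum_prob_fibres[OF J])
  also have "(\<Sum>j<n. \<Sum>a\<in>?F. neg_xlnx (prob (?Q j \<inter> X -` {a}))) = Ent (\<lambda>x. (J x, X x))"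
  proof -
    have eq: "?Q j \<inter> X -` {a} = (\<lambda>x. (J x, X x)) -` {(j, a)} \<inter> space M" for j a by auto
    show ?thesis
      unfolding eq sum.cartesian_product
      by (subst entropy_eq_sum[OF simple_function_Pair[OF J X], of "{..<n} \<times> ?F"])
         (use J_less simple_functionD(1)[OF X] in \<open>auto simp: case_prod_unfold\<close>)
  qed
  also have "\<dots> \<le> Ent J + Ent X"
    by (rule entropy_le_add_of_determines[OF J X]) auto
  also have "Ent J \<le> ln n"
  proof -
    have "Ent J \<le> log (exp 1) (real (card (J ` space M)))"
      by (rule entropy_le_card[OF simple_distributedI[OF J measure_nonneg refl]])
    also have "\<dots> \<le> ln n"
    proof -
      have "card (J ` space M) \<le> n" using card_mono[OF _ J_less] by simp
      moreover have "card (J ` space M) > 0"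
        using simple_functionD(1)[OF J] not_empty by (simp add: card_gt_0_iff)
      ultimately show ?thesis by (simp add: log_def)
    qed
    finally show ?thesis .
  qed
  finally show False using n by simp
qed

text \<open>Every fibre of probability \<open>p > 0\<close> has \<open>- ln p \<le> - ln \<delta>\<close>, so the entropy is an average of numbers
  bounded by \<open>- ln \<delta>\<close>, independently of the number of values of \<open>X\<close>.\<close>
lemma entropy_le_of_no_small_sets:
  assumes \<delta>: "\<delta> > 0" and big: "\<And>A. A \<in> sets M \<Longrightarrow> prob A > 0 \<Longrightarrow> \<delta> \<le> prob A"
    and X: "simple_function M X"
  shows "Ent X \<le> - ln \<delta>"
proof -
  have "Ent X = (\<Sum>y\<in>X ` space M. neg_xlnx (prob (X -` {y} \<inter> space M)))"
    by (rule entropy_eq_sum[OF X simple_functionD(1)[OF X] subset_refl])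
  also have "\<dots> \<le> (\<Sum>y\<in>X ` space M. prob (X -` {y} \<inter> space M)) * - ln \<delta>"
    unfolding sum_distrib_right
  proof (rule sum_mono)
    fix y
    let ?p = "prob (X -` {y} \<inter> space M)"
    show "neg_xlnx ?p \<le> ?p * - ln \<delta>"
    proof (cases "?p = 0")
      case False
      then have "?p > 0" by (simp add: zero_less_measure_iff)
      then have "ln \<delta> \<le> ln ?p" using big[OF simple_functionD(2)[OF X]] \<delta> by simp
      then show ?thesis unfolding neg_xlnx_def by (simp add: mult_left_mono)
    qed simp
  qed
  also have "\<dots> = - ln \<delta>" using sum_prob_fibres[OF X] by simp
  finally show ?thesis .
qed

end

section \<open>Covers and partitions\<close>

text \<open>The cell is returned as the set of all elements containing the point.  This makes sense for covers as well as for
  partitions, and on a partition it is the singleton of the usual cell.\<close>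
definition cell_of :: "'a set set \<Rightarrow> 'a \<Rightarrow> 'a set set" where
  "cell_of \<U> x = {U \<in> \<U>. x \<in> U}"

lemma simple_function_cell_of:
  assumes fin: "finite \<U>" and sets: "\<U> \<subseteq> sets M"
  shows "simple_function M (cell_of \<U>)"
  unfolding simple_function_def
proof
  have "cell_of \<U> ` space M \<subseteq> Pow \<U>" by (auto simp: cell_of_def)
  then show "finite (cell_of \<U> ` space M)" using fin by (meson finite_Pow_iff finite_subset)
  show "\<forall>W\<in>cell_of \<U> ` space M. cell_of \<U> -` {W} \<inter> space M \<in> sets M"
  proof
    fix W assume "W \<in> cell_of \<U> ` space M"
    then have W: "W \<subseteq> \<U>" by (auto simp: cell_of_def)
    have "cell_of \<U> -` {W} \<inter> space M = {x \<in> space M. \<forall>V\<in>\<U>. x \<in> (if V \<in> W then V else space M - V)}"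
    proof (intro set_eqI iffI)
      fix x assume "x \<in> cell_of \<U> -` {W} \<inter> space M"
      then show "x \<in> {x \<in> space M. \<forall>V\<in>\<U>. x \<in> (if V \<in> W then V else space M - V)}"
        by (auto simp: cell_of_def)
    next
      fix x assume x: "x \<in> {x \<in> space M. \<forall>V\<in>\<U>. x \<in> (if V \<in> W then V else space M - V)}"
      then have "V \<in> W \<longleftrightarrow> x \<in> V" if "V \<in> \<U>" for V
        using that by (metis (no_types, lifting) DiffD2 mem_Collect_eq)
      with W x show "x \<in> cell_of \<U> -` {W} \<inter> space M" by (auto simp: cell_of_def)
    qed
    moreover have "\<dots> \<in> sets M"
    proof (rule sets.sets_Collect_finite_All[OF _ fin])
      fix V assume "V \<in> \<U>"
      then have V: "V \<in> sets M" using sets by auto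
      have "{x \<in> space M. x \<in> (if V \<in> W then V else space M - V)} = (if V \<in> W then V else space M - V)"
        using sets.sets_into_space[OF V] by auto
      then show "{x \<in> space M. x \<in> (if V \<in> W then V else space M - V)} \<in> sets M" using V by simp
    qed
    ultimately show "cell_of \<U> -` {W} \<inter> space M \<in> sets M" by simp
  qed
qed

lemma cell_of_partition:
  assumes "is_partition M \<alpha>" "A \<in> \<alpha>" "x \<in> A"
  shows "cell_of \<alpha> x = {A}"
  using assms by (auto simp: is_partition_def cell_of_def disjoint_def)

lemma cell_of_partition_eq_iff:
  assumes p: "is_partition M \<alpha>" and x: "x \<in> space M" and y: "y \<in> space M"
  shows "cell_of \<alpha> x = cell_of \<alpha> y \<longleftrightarrow> (\<exists>A\<in>\<alpha>. x \<in> A \<and> y \<in> A)"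
proof
  assume eq: "cell_of \<alpha> x = cell_of \<alpha> y"
  obtain A where "A \<in> \<alpha>" "x \<in> A" using p x by (auto simp: is_partition_def is_cover_def)
  then show "\<exists>A\<in>\<alpha>. x \<in> A \<and> y \<in> A" using eq by (auto simp: cell_of_def)
next
  assume "\<exists>A\<in>\<alpha>. x \<in> A \<and> y \<in> A"
  then show "cell_of \<alpha> x = cell_of \<alpha> y" using cell_of_partition[OF p] by auto
qed

lemma simple_function_cell_of_partition: "is_partition M \<alpha> \<Longrightarrow> simple_function M (cell_of \<alpha>)"
  by (rule simple_function_cell_of) (auto simp: is_partition_def is_cover_def)

lemma measurable_funpow:
  assumes "T \<in> measurable M M" shows "T ^^ k \<in> measurable M M"
proof (induction k)
  case (Suc k)
  show ?case using measurable_comp[OF Suc assms] by (simp add: comp_def)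
qed (simp add: id_def)

lemma is_cover_join:
  assumes "is_cover M \<U>" "is_cover M \<V>" shows "is_cover M (cover_join \<U> \<V>)"
proof -
  have eq: "cover_join \<U> \<V> = (\<lambda>(U, V). U \<inter> V) ` (\<U> \<times> \<V>)" by (auto simp: cover_join_def)
  have "\<Union>(cover_join \<U> \<V>) = \<Union>\<U> \<inter> \<Union>\<V>" by (auto simp: cover_join_def)
  moreover have "cover_join \<U> \<V> \<subseteq> sets M"
    using assms by (auto simp: cover_join_def is_cover_def)
  ultimately show ?thesis using assms eq by (simp add: is_cover_def)
qed

lemma is_cover_preimage:
  assumes "is_cover M \<U>" "T \<in> measurable M M" shows "is_cover M (cover_preimage M T k \<U>)"
proof -
  have T: "T ^^ k \<in> measurable M M" by (rule measurable_funpow[OF assms(2)])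
  have "\<Union>(cover_preimage M T k \<U>) = (T ^^ k) -` \<Union>\<U> \<inter> space M"
    by (auto simp: cover_preimage_def)
  also have "\<dots> = space M" using assms(1) measurable_space[OF T] by (auto simp: is_cover_def)
  finally show ?thesis
    using assms(1) measurable_sets[OF T] by (auto simp: is_cover_def cover_preimage_def)
qed

lemma is_cover_iterated_join:
  assumes "is_cover M \<U>" "T \<in> measurable M M" shows "is_cover M (iterated_join M T \<U> n)"
  by (induction n) (auto intro: is_cover_join is_cover_preimage assms, simp add: is_cover_def)

lemma is_partition_iterated_join:
  assumes p: "is_partition M \<alpha>" and T: "T \<in> measurable M M"
  shows "is_partition M (iterated_join M T \<alpha> n)"
proof -
  have "disjoint (iterated_join M T \<alpha> n)"
  proof (induction n)
    case (Suc n)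
    have "disjoint (cover_preimage M T n \<alpha>)"
      using p unfolding is_partition_def disjoint_def cover_preimage_def by blast
    with Suc show ?case unfolding disjoint_def cover_join_def iterated_join.simps by blast
  qed simp
  then show ?thesis using p is_cover_iterated_join T by (auto simp: is_partition_def)
qed

lemma iterated_join_same_cell_iff:
  assumes "x \<in> space M" "y \<in> space M"
  shows "(\<exists>B\<in>iterated_join M T \<U> n. x \<in> B \<and> y \<in> B) \<longleftrightarrow>
    (\<forall>k<n. \<exists>A\<in>\<U>. (T ^^ k) x \<in> A \<and> (T ^^ k) y \<in> A)"
proof (induction n)
  case (Suc n)
  have "(\<exists>B\<in>iterated_join M T \<U> (Suc n). x \<in> B \<and> y \<in> B) \<longleftrightarrow>
     (\<exists>B\<in>iterated_join M T \<U> n. \<exists>A\<in>\<U>. x \<in> B \<inter> ((T ^^ n) -` A \<inter> space M) \<and> y \<in> B \<inter> ((T ^^ n) -` A \<inter> space M))"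
    by (auto simp: cover_join_def cover_preimage_def)
  also have "\<dots> \<longleftrightarrow>
     (\<exists>B\<in>iterated_join M T \<U> n. x \<in> B \<and> y \<in> B) \<and> (\<exists>A\<in>\<U>. (T ^^ n) x \<in> A \<and> (T ^^ n) y \<in> A)"
    using assms by auto
  finally have "(\<exists>B\<in>iterated_join M T \<U> (Suc n). x \<in> B \<and> y \<in> B) \<longleftrightarrow>
     (\<exists>B\<in>iterated_join M T \<U> n. x \<in> B \<and> y \<in> B) \<and> (\<exists>A\<in>\<U>. (T ^^ n) x \<in> A \<and> (T ^^ n) y \<in> A)" .
  then show ?case unfolding Suc.IH less_Suc_eq by blast
qed (use assms in auto)

lemma finer_iterated_join:
  assumes "finer \<alpha> \<U>" shows "finer (iterated_join M T \<alpha> n) (iterated_join M T \<U> n)"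
proof (induction n)
  case (Suc n)
  have "finer (cover_preimage M T n \<alpha>) (cover_preimage M T n \<U>)"
    unfolding finer_def
  proof
    fix W assume "W \<in> cover_preimage M T n \<alpha>"
    then obtain A where W: "W = (T ^^ n) -` A \<inter> space M" "A \<in> \<alpha>" by (auto simp: cover_preimage_def)
    then obtain U where "U \<in> \<U>" "A \<subseteq> U" using assms by (auto simp: finer_def)
    with W show "\<exists>V\<in>cover_preimage M T n \<U>. W \<subseteq> V" by (auto simp: cover_preimage_def)
  qed
  moreover have "finer (cover_join \<A> \<B>) (cover_join \<A>' \<B>')" if fin: "finer \<A> \<A>'" "finer \<B> \<B>'"
    for \<A> \<A>' \<B> \<B>' :: "'a set set"
    unfolding finer_def
  proof
    fix W assume "W \<in> cover_join \<A> \<B>"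
    then obtain A B where W: "W = A \<inter> B" "A \<in> \<A>" "B \<in> \<B>" by (auto simp: cover_join_def)
    then obtain A' B' where "A' \<in> \<A>'" "A \<subseteq> A'" "B' \<in> \<B>'" "B \<subseteq> B'"
      using fin unfolding finer_def by metis
    with W show "\<exists>V\<in>cover_join \<A>' \<B>'. W \<subseteq> V" by (auto simp: cover_join_def)
  qed
  ultimately show ?case using Suc by simp
qed (simp add: finer_def)

lemma iterated_join_elem_subset:
  assumes "B \<in> iterated_join M T \<U> n" "k < n"
  shows "\<exists>V\<in>\<U>. B \<subseteq> (T ^^ k) -` V"
  using assms
proof (induction n arbitrary: B)
  case (Suc n)
  then obtain C V where "B = C \<inter> ((T ^^ n) -` V \<inter> space M)" "C \<in> iterated_join M T \<U> n" "V \<in> \<U>"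
    by (auto simp: cover_join_def cover_preimage_def)
  note B = this
  show ?case
  proof (cases "k = n")
    case True
    with B show ?thesis by auto
  next
    case False
    then obtain V' where "V' \<in> \<U>" "C \<subseteq> (T ^^ k) -` V'"
      using Suc.IH[of C] Suc.prems B by auto
    with B show ?thesis by auto
  qed
qed simp

context prob_space
begin

interpretation information_space M "exp 1"
  by unfold_locales simp

text \<open>Entropy depends only on the equivalence relation of lying in the same cell, so any map with these
  fibres computes it.  An empty element of \<open>\<alpha>\<close> contributes \<open>0\<close>.\<close>
lemma partition_entropy_eq_entropy:
  assumes p: "is_partition M \<alpha>" and X: "simple_function M X"
    and iff: "\<And>x y. x \<in> space M \<Longrightarrow> y \<in> space M \<Longrightarrow> X x = X y \<longleftrightarrow> (\<exists>A\<in>\<alpha>. x \<in> A \<and> y \<in> A)"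
  shows "partition_entropy M \<alpha> = Ent X"
proof -
  have fin: "finite \<alpha>" and sets: "\<alpha> \<subseteq> sets M" and space: "\<Union>\<alpha> = space M"
    using p by (auto simp: is_partition_def is_cover_def)
  have C: "simple_function M (cell_of \<alpha>)" by (rule simple_function_cell_of[OF fin sets])
  have "Ent (cell_of \<alpha>) = (\<Sum>y\<in>(\<lambda>A. {A}) ` \<alpha>. neg_xlnx (prob (cell_of \<alpha> -` {y} \<inter> space M)))"
  proof (rule entropy_eq_sum[OF C])
    show "finite ((\<lambda>A. {A}) ` \<alpha>)" using fin by simp
    show "cell_of \<alpha> ` space M \<subseteq> (\<lambda>A. {A}) ` \<alpha>"
    proof
      fix W assume "W \<in> cell_of \<alpha> ` space M"
      then obtain x A where "W = cell_of \<alpha> x" "A \<in> \<alpha>" "x \<in> A" using space by blast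
      then show "W \<in> (\<lambda>A. {A}) ` \<alpha>" using cell_of_partition[OF p] by auto
    qed
  qed
  also have "\<dots> = (\<Sum>A\<in>\<alpha>. neg_xlnx (prob (cell_of \<alpha> -` {{A}} \<inter> space M)))"
    by (simp add: sum.reindex)
  also have "\<dots> = (\<Sum>A\<in>\<alpha>. neg_xlnx (prob A))"
  proof (rule sum.cong[OF refl])
    fix A assume A: "A \<in> \<alpha>"
    have "cell_of \<alpha> -` {{A}} \<inter> space M = A"
    proof (intro set_eqI iffI)
      fix x assume "x \<in> cell_of \<alpha> -` {{A}} \<inter> space M"
      then show "x \<in> A" by (auto simp: cell_of_def)
    next
      fix x assume "x \<in> A"
      then show "x \<in> cell_of \<alpha> -` {{A}} \<inter> space M"
        using cell_of_partition[OF p A] A space by auto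
    qed
    then show "neg_xlnx (prob (cell_of \<alpha> -` {{A}} \<inter> space M)) = neg_xlnx (prob A)" by simp
  qed
  also have "\<dots> = partition_entropy M \<alpha>"
    by (simp add: neg_xlnx_def partition_entropy_def sum_negf)
  finally have "partition_entropy M \<alpha> = Ent (cell_of \<alpha>)" by simp
  also have "\<dots> = Ent X"
  proof (rule antisym)
    show "Ent (cell_of \<alpha>) \<le> Ent X"
      by (rule entropy_le_of_determines[OF X]) (simp add: iff cell_of_partition_eq_iff[OF p])
    show "Ent X \<le> Ent (cell_of \<alpha>)"
      by (rule entropy_le_of_determines[OF C]) (simp add: iff cell_of_partition_eq_iff[OF p])
  qed
  finally show ?thesis .
qed

lemma partition_entropy_nonneg:
  assumes p: "is_partition M \<alpha>" shows "0 \<le> partition_entropy M \<alpha>"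
proof -
  note C = simple_function_cell_of_partition[OF p]
  have "partition_entropy M \<alpha> = Ent (cell_of \<alpha>)"
    by (rule partition_entropy_eq_entropy[OF p C cell_of_partition_eq_iff[OF p]])
  then show ?thesis using entropy_nonneg[OF C] by simp
qed

lemma cover_entropy_le_partition_entropy:
  assumes "is_partition M \<alpha>" "finer \<alpha> \<U>"
  shows "cover_entropy M \<U> \<le> partition_entropy M \<alpha>"
  unfolding cover_entropy_def
  by (rule cInf_lower) (use assms partition_entropy_nonneg in \<open>auto intro!: bdd_belowI[of _ 0]\<close>)

text \<open>Partitions finer than \<open>\<U>\<close> arise by choosing measurably, for each point, an element of the cover
  that contains it.\<close>
lemma partition_of_selection:
  assumes cover: "is_cover M \<U>" and Y: "simple_function M Y"
    and sel: "\<And>x. x \<in> space M \<Longrightarrow> Y x \<in> \<U> \<and> x \<in> Y x"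
  obtains \<beta> where "is_partition M \<beta>" "finer \<beta> \<U>"
    and "\<And>x y. x \<in> space M \<Longrightarrow> y \<in> space M \<Longrightarrow> Y x = Y y \<longleftrightarrow> (\<exists>A\<in>\<beta>. x \<in> A \<and> y \<in> A)"
proof
  let ?\<beta> = "(\<lambda>V. Y -` {V} \<inter> space M) ` \<U>"
  show "is_partition M ?\<beta>"
    unfolding is_partition_def is_cover_def
  proof (intro conjI)
    show "finite ?\<beta>" using cover by (simp add: is_cover_def)
    show "?\<beta> \<subseteq> sets M" using simple_functionD(2)[OF Y] by auto
    show "\<Union>?\<beta> = space M" using sel by auto
    show "disjoint ?\<beta>" by (auto simp: disjoint_def)
  qed
  show "finer ?\<beta> \<U>"
    unfolding finer_def
  proof
    fix A assume "A \<in> ?\<beta>"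
    then obtain V where "V \<in> \<U>" "A = Y -` {V} \<inter> space M" by auto
    then show "\<exists>V\<in>\<U>. A \<subseteq> V" using sel by auto
  qed
  show "Y x = Y y \<longleftrightarrow> (\<exists>A\<in>?\<beta>. x \<in> A \<and> y \<in> A)" if "x \<in> space M" "y \<in> space M" for x y
    using that sel by auto
qed

text \<open>Choosing as a function of \<open>cell_of \<U> x\<close> rather than of \<open>x\<close> makes the choice measurable.\<close>
lemma exists_simple_selection:
  assumes cover: "is_cover M \<U>"
  obtains c where "simple_function M c" "\<And>x. x \<in> space M \<Longrightarrow> c x \<in> \<U> \<and> x \<in> c x"
proof
  let ?c = "\<lambda>x. SOME V. V \<in> cell_of \<U> x"
  show "simple_function M ?c"
    using cover by (intro simple_function_compose1[of M "cell_of \<U>" "\<lambda>W. SOME V. V \<in> W"] simple_function_cell_of)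
      (auto simp: is_cover_def)
  fix x assume "x \<in> space M"
  then obtain U where "U \<in> \<U>" "x \<in> U" using cover by (auto simp: is_cover_def)
  then have "?c x \<in> cell_of \<U> x" by (intro someI[of "\<lambda>V. V \<in> cell_of \<U> x" U]) (simp add: cell_of_def)
  then show "?c x \<in> \<U> \<and> x \<in> ?c x" by (simp add: cell_of_def)
qed

lemma exists_finer_partition:
  assumes cover: "is_cover M \<U>"
  obtains \<alpha> where "is_partition M \<alpha>" "finer \<alpha> \<U>"
  using exists_simple_selection[OF cover] partition_of_selection[OF cover] by metis

end

section \<open>Itineraries and dynamical entropy\<close>

definition itinerary :: "('a \<Rightarrow> 'a) \<Rightarrow> ('a \<Rightarrow> 'b) \<Rightarrow> nat \<Rightarrow> 'a \<Rightarrow> 'b list" where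
  "itinerary T X n x = map (\<lambda>k. X ((T ^^ k) x)) [0..<n]"

lemma itinerary_eq_iff:
  "itinerary T X n x = itinerary T X n y \<longleftrightarrow> (\<forall>k<n. X ((T ^^ k) x) = X ((T ^^ k) y))"
  by (auto simp: itinerary_def)

lemma itinerary_nth: "i < n \<Longrightarrow> itinerary T X n x ! i = X ((T ^^ i) x)"
  by (simp add: itinerary_def)

lemma simple_function_measurable_comp:
  assumes X: "simple_function N X" and g: "g \<in> measurable M N"
  shows "simple_function M (\<lambda>x. X (g x))"
  unfolding simple_function_eq_measurable
proof
  have "(\<lambda>x. X (g x)) ` space M \<subseteq> X ` space N" using measurable_space[OF g] by auto
  then show "finite ((\<lambda>x. X (g x)) ` space M)"
    using simple_functionD(1)[OF X] finite_subset by blast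
  show "(\<lambda>x. X (g x)) \<in> measurable M (count_space UNIV)"
    using measurable_compose[OF g measurable_simple_function[OF X]] .
qed

lemma simple_function_itinerary:
  assumes "T \<in> measurable M M" and X: "simple_function M X"
  shows "simple_function M (itinerary T X n)"
proof (induction n)
  case (Suc n)
  have "itinerary T X (Suc n) = (\<lambda>x. itinerary T X n x @ [X ((T ^^ n) x)])"
    by (simp add: itinerary_def fun_eq_iff)
  then show ?case
    using simple_function_compose2[OF Suc simple_function_measurable_comp[OF X measurable_funpow[OF assms(1), of n]],
        of "\<lambda>w v. w @ [v]"] by simp
qed (simp add: itinerary_def[abs_def])

sublocale dynamical_system \<subseteq> information_space M "exp 1"
  by unfold_locales simp

context dynamical_system
begin

lemma funpow_in_space: "x \<in> space M \<Longrightarrow> (T ^^ k) x \<in> space M"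
  using measurable_space[OF measurable_funpow[OF meas]] .

lemma prob_funpow_vimage:
  assumes "A \<in> sets M" shows "prob ((T ^^ k) -` A \<inter> space M) = prob A"
proof (induction k)
  case (Suc k)
  have T: "T ^^ k \<in> measurable M M" by (rule measurable_funpow[OF meas])
  have "(T ^^ Suc k) -` A \<inter> space M = T -` ((T ^^ k) -` A \<inter> space M) \<inter> space M"
    using funpow_in_space[of _ 1] by (auto simp: funpow_swap1)
  then have "prob ((T ^^ Suc k) -` A \<inter> space M) = measure (distr M M T) ((T ^^ k) -` A \<inter> space M)"
    using measure_distr[OF meas measurable_sets[OF T assms]] by simp
  then show ?case using Suc by (simp add: preserving comp_def)
qed (use sets.sets_into_space[OF assms] in \<open>simp add: Int_absorb2\<close>)

lemma funpow_image_space: "(T ^^ k) ` space M = space M"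
proof (induction k)
  case (Suc k)
  then show ?case
    using bij unfolding funpow.simps image_comp[symmetric] by (simp add: bij_betw_def)
qed simp

lemma entropy_funpow:
  assumes X: "simple_function M X"
  shows "Ent (\<lambda>x. X ((T ^^ k) x)) = Ent X"
proof -
  have Xk: "simple_function M (\<lambda>x. X ((T ^^ k) x))"
    by (rule simple_function_measurable_comp[OF X measurable_funpow[OF meas]])
  have img: "(\<lambda>x. X ((T ^^ k) x)) ` space M = X ` space M"
    using funpow_image_space[of k] by (metis image_image)
  have "prob ((\<lambda>x. X ((T ^^ k) x)) -` {y} \<inter> space M) = prob (X -` {y} \<inter> space M)" for y
  proof -
    have "(\<lambda>x. X ((T ^^ k) x)) -` {y} \<inter> space M = (T ^^ k) -` (X -` {y} \<inter> space M) \<inter> space M"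
      using funpow_in_space by auto
    then show ?thesis using prob_funpow_vimage[OF simple_functionD(2)[OF X]] by simp
  qed
  then show ?thesis
    unfolding entropy_eq_sum[OF X simple_functionD(1)[OF X] subset_refl]
      entropy_eq_sum[OF Xk simple_functionD(1)[OF X] equalityD1[OF img]] by simp
qed

lemma entropy_itinerary_add:
  assumes X: "simple_function M X"
  shows "Ent (itinerary T X (m + n)) \<le> Ent (itinerary T X m) + Ent (itinerary T X n)"
proof -
  note W = simple_function_itinerary[OF meas X]
  have "Ent (itinerary T X (m + n)) \<le> Ent (itinerary T X m) + Ent (\<lambda>x. itinerary T X n ((T ^^ m) x))"
  proof (rule entropy_le_add_of_determines[OF W simple_function_measurable_comp[OF W measurable_funpow[OF meas]]])
    fix x y
    assume 1: "itinerary T X m x = itinerary T X m y"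
      and 2: "itinerary T X n ((T ^^ m) x) = itinerary T X n ((T ^^ m) y)"
    show "itinerary T X (m + n) x = itinerary T X (m + n) y"
      unfolding itinerary_eq_iff
    proof (intro allI impI)
      fix k assume k: "k < m + n"
      show "X ((T ^^ k) x) = X ((T ^^ k) y)"
      proof (cases "k < m")
        case True
        then show ?thesis using 1 by (simp add: itinerary_eq_iff)
      next
        case False
        then have "X ((T ^^ (k - m)) ((T ^^ m) x)) = X ((T ^^ (k - m)) ((T ^^ m) y))"
          using 2 k by (simp add: itinerary_eq_iff)
        then show ?thesis using False funpow_add[of "k - m" m T] by simp
      qed
    qed
  qed
  then show ?thesis using entropy_funpow[OF W] by simp
qed

lemma entropy_itinerary_le:
  assumes X: "simple_function M X"
  shows "Ent (itinerary T X n) \<le> real n * Ent X"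
proof (induction n)
  case 0
  show ?case
    using entropy_eq_sum[OF simple_function_itinerary[OF meas X], of "{[]}" 0]
    by (simp add: itinerary_def[abs_def] image_subset_iff prob_space neg_xlnx_def)
next
  case (Suc n)
  have "Ent (itinerary T X 1) \<le> Ent X"
    by (rule entropy_le_of_determines[OF X]) (simp add: itinerary_eq_iff)
  with Suc entropy_itinerary_add[OF X, of n 1] show ?case by (simp add: algebra_simps)
qed

lemma entropy_itinerary_convergent:
  assumes X: "simple_function M X"
  shows "convergent (\<lambda>n. Ent (itinerary T X n) / real n)"
  by (rule subadditive_imp_convergent_average)
    (intro entropy_nonneg simple_function_itinerary meas X entropy_itinerary_add)+

text \<open>If \<open>Y\<close> at one time is computed from a window of \<open>n + 1\<close> values of \<open>X\<close>, then \<open>m\<close> consecutive values of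
  \<open>Y\<close> need only \<open>m + n\<close> values of \<open>X\<close>: overlapping windows share their entries, so the
  length of the window does not affect the entropy per unit of time.  The window ends at the time of \<open>Y\<close> and
  reaches into the past; starting \<open>n\<close> steps early expresses this without inverting \<open>T\<close>.\<close>
lemma entropy_itinerary_block_code_le:
  assumes X: "simple_function M X" and Y: "simple_function M Y"
    and code: "\<And>x y. x \<in> space M \<Longrightarrow> y \<in> space M \<Longrightarrow> (\<forall>l\<le>n. X ((T ^^ l) x) = X ((T ^^ l) y))
      \<Longrightarrow> Y ((T ^^ n) x) = Y ((T ^^ n) y)"
  shows "Ent (itinerary T Y m) \<le> real (m + n) * Ent X"
proof -
  have "Ent (itinerary T Y m) = Ent (\<lambda>x. itinerary T Y m ((T ^^ n) x))"
    using entropy_funpow[OF simple_function_itinerary[OF meas Y]] by simp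
  also have "\<dots> \<le> Ent (itinerary T X (m + n))"
  proof (rule entropy_le_of_determines[OF simple_function_itinerary[OF meas X]])
    fix x y assume xy: "x \<in> space M" "y \<in> space M"
      and eq: "itinerary T X (m + n) x = itinerary T X (m + n) y"
    show "itinerary T Y m ((T ^^ n) x) = itinerary T Y m ((T ^^ n) y)"
      unfolding itinerary_eq_iff
    proof (intro allI impI)
      fix k assume k: "k < m"
      have swap: "(T ^^ k) ((T ^^ n) z) = (T ^^ n) ((T ^^ k) z)" for z
        by (metis add.commute comp_apply funpow_add)
      have "Y ((T ^^ n) ((T ^^ k) x)) = Y ((T ^^ n) ((T ^^ k) y))"
      proof (rule code[OF funpow_in_space[OF xy(1)] funpow_in_space[OF xy(2)]], intro allI impI)
        fix l assume "l \<le> n"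
        then have "X ((T ^^ (l + k)) x) = X ((T ^^ (l + k)) y)"
          using eq k by (simp add: itinerary_eq_iff)
        then show "X ((T ^^ l) ((T ^^ k) x)) = X ((T ^^ l) ((T ^^ k) y))"
          by (simp add: funpow_add)
      qed
      then show "Y ((T ^^ k) ((T ^^ n) x)) = Y ((T ^^ k) ((T ^^ n) y))" by (simp add: swap)
    qed
  qed
  also have "\<dots> \<le> real (m + n) * Ent X" by (rule entropy_itinerary_le[OF X])
  finally show ?thesis .
qed

lemma partition_entropy_iterated_join:
  assumes p: "is_partition M \<alpha>" and X: "simple_function M X"
    and iff: "\<And>x y. x \<in> space M \<Longrightarrow> y \<in> space M \<Longrightarrow> X x = X y \<longleftrightarrow> (\<exists>A\<in>\<alpha>. x \<in> A \<and> y \<in> A)"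
  shows "partition_entropy M (iterated_join M T \<alpha> n) = Ent (itinerary T X n)"
proof (rule partition_entropy_eq_entropy[OF is_partition_iterated_join[OF p meas] simple_function_itinerary[OF meas X]])
  fix x y assume xy: "x \<in> space M" "y \<in> space M"
  have T: "(T ^^ k) z \<in> space M" if "z \<in> space M" for k z
    using measurable_space[OF measurable_funpow[OF meas] that] .
  show "itinerary T X n x = itinerary T X n y \<longleftrightarrow> (\<exists>B\<in>iterated_join M T \<alpha> n. x \<in> B \<and> y \<in> B)"
    unfolding itinerary_eq_iff iterated_join_same_cell_iff[OF xy]
    using iff[OF T[OF xy(1)] T[OF xy(2)]] by simp
qed

lemma partition_entropy_average_tendsto:
  assumes p: "is_partition M \<alpha>"
  shows "(\<lambda>n. partition_entropy M (iterated_join M T \<alpha> n) / real n) \<longlonglongrightarrow> dynamical_entropy M T \<alpha>"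
proof -
  note C = simple_function_cell_of_partition[OF p]
  have "partition_entropy M (iterated_join M T \<alpha> n) = Ent (itinerary T (cell_of \<alpha>) n)" for n
    by (rule partition_entropy_iterated_join[OF p C cell_of_partition_eq_iff[OF p]])
  then show ?thesis
    using entropy_itinerary_convergent[OF C] by (simp add: dynamical_entropy_def convergent_LIMSEQ_iff)
qed

lemma dynamical_entropy_nonneg:
  assumes p: "is_partition M \<alpha>" shows "0 \<le> dynamical_entropy M T \<alpha>"
  by (rule LIMSEQ_le_const[OF partition_entropy_average_tendsto[OF p]])
    (auto intro!: partition_entropy_nonneg is_partition_iterated_join[OF p meas] divide_nonneg_nonneg)

lemma h_plus_le_dynamical_entropy:
  assumes "is_partition M \<alpha>" "finer \<alpha> \<U>"
  shows "h_plus M T \<U> \<le> dynamical_entropy M T \<alpha>"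
  unfolding h_plus_def
  by (rule cInf_lower) (use assms dynamical_entropy_nonneg in \<open>auto intro!: bdd_belowI[of _ 0]\<close>)

lemma h_plus_le_of_selection:
  assumes cover: "is_cover M \<U>" and Y: "simple_function M Y"
    and sel: "\<And>x. x \<in> space M \<Longrightarrow> Y x \<in> \<U> \<and> x \<in> Y x"
    and bound: "\<And>m. Ent (itinerary T Y m) \<le> real (m + n) * L"
  shows "h_plus M T \<U> \<le> L"
proof -
  obtain \<beta> where \<beta>: "is_partition M \<beta>" "finer \<beta> \<U>"
    and iff: "\<And>x y. x \<in> space M \<Longrightarrow> y \<in> space M \<Longrightarrow> Y x = Y y \<longleftrightarrow> (\<exists>A\<in>\<beta>. x \<in> A \<and> y \<in> A)"
    using partition_of_selection[OF cover Y sel] by metis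
  have "dynamical_entropy M T \<beta> \<le> L"
  proof (rule LIMSEQ_le[OF partition_entropy_average_tendsto[OF \<beta>(1)]])
    have "(\<lambda>m. L + (n * L) / real m) \<longlonglongrightarrow> L + 0"
      by (intro tendsto_add tendsto_const lim_const_over_n)
    then show "(\<lambda>m. L + (n * L) / real m) \<longlonglongrightarrow> L" by simp
    show "\<exists>N. \<forall>m\<ge>N. partition_entropy M (iterated_join M T \<beta> m) / real m \<le> L + n * L / real m"
    proof (intro exI[of _ 1] allI impI)
      fix m :: nat assume m: "1 \<le> m"
      have "partition_entropy M (iterated_join M T \<beta> m) / real m \<le> real (m + n) * L / real m"
        using bound[of m] partition_entropy_iterated_join[OF \<beta>(1) Y iff, of m]
        by (intro divide_right_mono) simp_all
      also have "\<dots> = L + n * L / real m" using m by (simp add: field_simps)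
      finally show "partition_entropy M (iterated_join M T \<beta> m) / real m \<le> L + n * L / real m" .
    qed
  qed
  with h_plus_le_dynamical_entropy[OF \<beta>] show ?thesis by simp
qed

lemma h_plus_le_0_of_no_small_sets:
  assumes \<delta>: "\<delta> > 0" and big: "\<And>A. A \<in> sets M \<Longrightarrow> prob A > 0 \<Longrightarrow> \<delta> \<le> prob A"
    and cover: "is_cover M \<U>"
  shows "h_plus M T \<U> \<le> 0"
proof -
  obtain \<alpha> where \<alpha>: "is_partition M \<alpha>" "finer \<alpha> \<U>" using exists_finer_partition[OF cover] by blast
  note C = simple_function_cell_of_partition[OF \<alpha>(1)]
  have "dynamical_entropy M T \<alpha> \<le> 0"
  proof (rule LIMSEQ_le[OF partition_entropy_average_tendsto[OF \<alpha>(1)] lim_const_over_n])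
    have "partition_entropy M (iterated_join M T \<alpha> n) \<le> - ln \<delta>" for n
      using entropy_le_of_no_small_sets[OF \<delta> big simple_function_itinerary[OF meas C]]
        partition_entropy_iterated_join[OF \<alpha>(1) C cell_of_partition_eq_iff[OF \<alpha>(1)]] by simp
    then show "\<exists>N. \<forall>n\<ge>N. partition_entropy M (iterated_join M T \<alpha> n) / real n \<le> - ln \<delta> / real n"
      by (intro exI[of _ 0] allI impI divide_right_mono) auto
  qed
  then show ?thesis using h_plus_le_dynamical_entropy[OF \<alpha>] by simp
qed

end

section \<open>Marking the starting points of blocks\<close>

context dynamical_system
begin

lemma funpow_inv_into:
  assumes "x \<in> space M" "i \<le> l"
  shows "(T ^^ l) ((inv_into (space M) T ^^ i) x) = (T ^^ (l - i)) x"
    and "(inv_into (space M) T ^^ i) ((T ^^ l) x) = (T ^^ (l - i)) x"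
proof -
  let ?S = "inv_into (space M) T"
  have S: "(?S ^^ i) y \<in> space M" if "y \<in> space M" for i y
    using measurable_space[OF measurable_funpow[OF meas_inv] that] .
  have TS: "T (?S y) = y" if "y \<in> space M" for y
    using bij that by (simp add: bij_betw_def f_inv_into_f)
  have ST: "?S (T y) = y" if "y \<in> space M" for y
    using bij that by (simp add: bij_betw_def)
  have 1: "(T ^^ i) ((?S ^^ i) y) = y" if "y \<in> space M" for y i
  proof (induction i)
    case (Suc i)
    have "(T ^^ Suc i) ((?S ^^ Suc i) y) = (T ^^ i) (T (?S ((?S ^^ i) y)))"
      by (simp add: funpow_swap1)
    then show ?case using Suc TS[OF S[OF that]] by simp
  qed simp
  have 2: "(?S ^^ i) ((T ^^ i) y) = y" if "y \<in> space M" for y i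
  proof (induction i)
    case (Suc i)
    have "(?S ^^ Suc i) ((T ^^ Suc i) y) = (?S ^^ i) (?S (T ((T ^^ i) y)))"
      by (simp add: funpow_swap1)
    then show ?case using Suc ST[OF funpow_in_space[OF that]] by simp
  qed simp
  have l: "T ^^ l = T ^^ (l - i) \<circ> T ^^ i" "T ^^ l = T ^^ i \<circ> T ^^ (l - i)"
    using assms(2) by (simp_all add: funpow_add[symmetric])
  show "(T ^^ l) ((?S ^^ i) x) = (T ^^ (l - i)) x" using 1[OF assms(1)] by (simp add: l(1))
  show "(?S ^^ i) ((T ^^ l) x) = (T ^^ (l - i)) x"
    using 2[OF funpow_in_space[OF assms(1)]] by (simp add: l(2))
qed

lemma inv_into_funpow_in_space: "x \<in> space M \<Longrightarrow> (inv_into (space M) T ^^ i) x \<in> space M"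
  using measurable_space[OF measurable_funpow[OF meas_inv]] .

lemma prob_inv_into_funpow_vimage:
  assumes A: "A \<in> sets M"
  shows "prob ((inv_into (space M) T ^^ i) -` A \<inter> space M) = prob A"
proof -
  let ?S = "inv_into (space M) T"
  have B: "(?S ^^ i) -` A \<inter> space M \<in> sets M"
    using measurable_sets[OF measurable_funpow[OF meas_inv] A] .
  have "(T ^^ i) -` ((?S ^^ i) -` A \<inter> space M) \<inter> space M = A"
    using funpow_inv_into(2)[of _ i i] funpow_in_space sets.sets_into_space[OF A] by auto
  then show ?thesis using prob_funpow_vimage[OF B, of i] by simp
qed

end

context ergodic_system
begin

text \<open>Ergodicity speaks of exactly invariant sets, but the set of points that visit \<open>E\<close> at all may be strictly
  larger than its preimage under \<open>T\<close>.  The set of points with infinitely many visits is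
  exactly invariant.  It is the decreasing intersection of the sets \<open>F m\<close> of points that visit \<open>E\<close> at some
  time \<open>\<ge> m\<close>; each \<open>F m\<close> is a preimage of \<open>F 0\<close>, which contains \<open>E\<close>, so the intersection has positive measure.\<close>
lemma prob_infinitely_many_visits:
  assumes E: "E \<in> sets M" and pos: "prob E > 0"
  shows "{x \<in> space M. \<forall>m. \<exists>k\<ge>m. (T ^^ k) x \<in> E} \<in> sets M"
    and "prob {x \<in> space M. \<forall>m. \<exists>k\<ge>m. (T ^^ k) x \<in> E} = 1"
proof -
  define F where "F m = {x \<in> space M. \<exists>k\<ge>m. (T ^^ k) x \<in> E}" for m
  define G where "G = {x \<in> space M. \<forall>m. \<exists>k\<ge>m. (T ^^ k) x \<in> E}"
  have F_eq: "F m = (\<Union>k\<in>{m..}. (T ^^ k) -` E \<inter> space M)" for m by (auto simp: F_def)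
  have F: "F m \<in> sets M" for m
    unfolding F_eq using measurable_sets[OF measurable_funpow[OF meas] E] by (intro sets.countable_UN') auto
  have G_eq: "G = (\<Inter>m. F m)" by (auto simp: G_def F_def)
  have G: "G \<in> sets M" unfolding G_eq using F by auto
  have shift: "F m = (T ^^ m) -` F 0 \<inter> space M" for m
  proof (intro set_eqI iffI)
    fix x assume "x \<in> F m"
    then obtain k where k: "k \<ge> m" "(T ^^ k) x \<in> E" and x: "x \<in> space M" by (auto simp: F_def)
    have "T ^^ k = T ^^ (k - m) \<circ> T ^^ m" using k by (simp add: funpow_add[symmetric])
    with k x show "x \<in> (T ^^ m) -` F 0 \<inter> space M" using funpow_in_space by (auto simp: F_def)
  next
    fix x assume "x \<in> (T ^^ m) -` F 0 \<inter> space M"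
    then obtain k where "(T ^^ (k + m)) x \<in> E" "x \<in> space M" by (auto simp: F_def funpow_add)
    then show "x \<in> F m" unfolding F_def by (auto intro!: exI[of _ "k + m"])
  qed
  have "(\<lambda>m. prob (F m)) \<longlonglongrightarrow> prob (\<Inter>m. F m)"
  proof (rule finite_Lim_measure_decseq)
    show "range F \<subseteq> sets M" using F by auto
    show "decseq F" by (rule decseq_SucI) (auto simp: F_def intro: Suc_leD)
  qed
  moreover have "prob (F m) = prob (F 0)" for m
    using prob_funpow_vimage[OF F[of 0], of m] shift[of m] by simp
  then have "(\<lambda>m. prob (F m)) = (\<lambda>m. prob (F 0))" by (rule ext)
  ultimately have "(\<lambda>m::nat. prob (F 0)) \<longlonglongrightarrow> prob G" unfolding G_eq by metis
  then have "prob G = prob (F 0)" by (simp add: LIMSEQ_const_iff)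
  moreover have "prob E \<le> prob (F 0)"
  proof (rule finite_measure_mono[OF _ F])
    show "E \<subseteq> F 0" using sets.sets_into_space[OF E] by (auto simp: F_def intro!: exI[of _ 0])
  qed
  ultimately have "prob G > 0" using pos by simp
  moreover have "T -` G \<inter> space M = G"
  proof (intro set_eqI iffI)
    fix x assume "x \<in> T -` G \<inter> space M"
    then have x: "x \<in> space M" and ev: "\<exists>k\<ge>m. (T ^^ k) (T x) \<in> E" for m by (auto simp: G_def)
    have "\<exists>k\<ge>m. (T ^^ k) x \<in> E" for m
    proof -
      obtain k where "k \<ge> m" "(T ^^ k) (T x) \<in> E" using ev by blast
      then show ?thesis by (intro exI[of _ "Suc k"]) (simp add: funpow_swap1)
    qed
    with x show "x \<in> G" by (simp add: G_def)
  next
    fix x assume "x \<in> G"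
    then have x: "x \<in> space M" and ev: "\<exists>k\<ge>m. (T ^^ k) x \<in> E" for m by (auto simp: G_def)
    have "\<exists>k\<ge>m. (T ^^ k) (T x) \<in> E" for m
    proof -
      obtain k where "k \<ge> Suc m" "(T ^^ k) x \<in> E" using ev by blast
      then show ?thesis by (intro exI[of _ "k - 1"]) (cases k, auto simp: funpow_swap1)
    qed
    with x show "x \<in> T -` G \<inter> space M" using funpow_in_space[OF x, of 1] by (simp add: G_def)
  qed
  ultimately have "prob G = 1" using ergodic[OF G] by auto
  with G show "{x \<in> space M. \<forall>m. \<exists>k\<ge>m. (T ^^ k) x \<in> E} \<in> sets M"
    and "prob {x \<in> space M. \<forall>m. \<exists>k\<ge>m. (T ^^ k) x \<in> E} = 1"
    unfolding G_def by blast+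
qed

text \<open>Let \<open>J\<close> be the hitting time of a set \<open>E\<close> of measure below \<open>\<epsilon> / n\<close>, modulo \<open>n\<close>.  Going backwards along an
  orbit that does not meet \<open>E\<close>, the hitting time grows by one at each step, so \<open>J\<close> runs through all residues
  within \<open>n\<close> steps.  The exceptional points have an \<open>i\<close>-th preimage in \<open>E\<close> for some \<open>i < n\<close>, or
  visit \<open>E\<close> only finitely often.\<close>
lemma exists_clock:
  fixes n :: nat
  assumes small: "\<And>\<delta>. \<delta> > 0 \<Longrightarrow> \<exists>A\<in>sets M. 0 < prob A \<and> prob A < \<delta>"
    and n: "n > 0" and \<epsilon>: "\<epsilon> > 0"
  obtains J :: "'a \<Rightarrow> nat" where "simple_function M J" "J ` space M \<subseteq> {..<n}"
    and "\<And>j. j < n \<Longrightarrow> prob {x \<in> space M. \<forall>i<n. J ((inv_into (space M) T ^^ i) x) \<noteq> j} \<le> \<epsilon>"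
proof -
  let ?S = "inv_into (space M) T"
  obtain E where E: "E \<in> sets M" "0 < prob E" "prob E < \<epsilon> / n"
    using small[of "\<epsilon> / n"] n \<epsilon> by auto
  define G where "G = {x \<in> space M. \<forall>m. \<exists>k\<ge>m. (T ^^ k) x \<in> E}"
  have G: "G \<in> sets M" "prob G = 1"
    unfolding G_def by (rule prob_infinitely_many_visits[OF E(1,2)])+
  define r where "r x = (LEAST k. (T ^^ k) x \<in> E)" for x
  define J where "J x = r x mod n" for x
  have "r \<in> measurable M (count_space UNIV)"
    unfolding r_def using measurable_sets[OF measurable_funpow[OF meas] E(1)]
    by (intro measurable_Least) (simp add: pred_def vimage_def Int_def conj_commute)
  then have "J \<in> measurable M (count_space UNIV)"
    unfolding J_def[abs_def] by (rule measurable_compose) simp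
  moreover have J_less: "J ` space M \<subseteq> {..<n}" using n by (auto simp: J_def)
  ultimately have J: "simple_function M J"
    unfolding simple_function_eq_measurable using finite_subset by blast
  have "prob {x \<in> space M. \<forall>i<n. J ((?S ^^ i) x) \<noteq> j} \<le> \<epsilon>" if j: "j < n" for j
  proof -
    let ?Err = "{x \<in> space M. \<forall>i<n. J ((?S ^^ i) x) \<noteq> j}"
    let ?E = "\<lambda>i. (?S ^^ i) -` E \<inter> space M"
    have Es: "?E i \<in> sets M" for i using measurable_sets[OF measurable_funpow[OF meas_inv] E(1)] .
    have "?Err \<subseteq> (space M - G) \<union> (\<Union>i<n. ?E i)"
    proof
      fix x assume "x \<in> ?Err"
      then have x: "x \<in> space M" and no_j: "\<And>i. i < n \<Longrightarrow> J ((?S ^^ i) x) \<noteq> j" by auto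
      show "x \<in> (space M - G) \<union> (\<Union>i<n. ?E i)"
      proof (rule ccontr)
        assume "\<not> ?thesis"
        then have xG: "x \<in> G" and no_E: "\<And>i. i < n \<Longrightarrow> (?S ^^ i) x \<notin> E" using x by auto
        define k where "k = r x"
        (* k + i is congruent to j; adding n keeps the subtraction of naturals exact. *)
        define i where "i = (j + n - k mod n) mod n"
        have i: "i < n" using n by (simp add: i_def)
        have hit: "(T ^^ k) x \<in> E"
        proof -
          obtain l where "(T ^^ l) x \<in> E" using xG by (auto simp: G_def)
          then show ?thesis unfolding k_def r_def by (rule LeastI)
        qed
        have "r ((?S ^^ i) x) = k + i"
          unfolding r_def
        proof (rule Least_equality)
          show "(T ^^ (k + i)) ((?S ^^ i) x) \<in> E"
            using funpow_inv_into(1)[OF x, of i "k + i"] hit by simp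
        next
          fix l assume l: "(T ^^ l) ((?S ^^ i) x) \<in> E"
          show "k + i \<le> l"
          proof (cases "i \<le> l")
            case True
            then have "(T ^^ (l - i)) x \<in> E" using funpow_inv_into(1)[OF x True] l by simp
            then have "k \<le> l - i" unfolding k_def r_def by (rule Least_le)
            then show ?thesis using True by simp
          next
            case False
            have "(?S ^^ i) x = (?S ^^ l) ((?S ^^ (i - l)) x)"
              using False funpow_add[of l "i - l" ?S] by simp
            then have "(T ^^ l) ((?S ^^ i) x) = (?S ^^ (i - l)) x"
              using funpow_inv_into(1)[OF inv_into_funpow_in_space[OF x], of l l "i - l"] by simp
            then show ?thesis using no_E[of "i - l"] l i by simp
          qed
        qed
        moreover have "(k + i) mod n = j"
        proof -
          have "(k + i) mod n = (k mod n + (j + n - k mod n)) mod n"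
            unfolding i_def by (simp add: mod_simps)
          also have "k mod n + (j + n - k mod n) = j + n"
            using n mod_less_divisor[of n k] by linarith
          finally show ?thesis using j by simp
        qed
        ultimately show False using no_j[OF i] by (simp add: J_def)
      qed
    qed
    then have "prob ?Err \<le> prob ((space M - G) \<union> (\<Union>i<n. ?E i))"
      by (rule finite_measure_mono) (intro sets.Un sets.finite_UN sets.compl_sets G Es finite_lessThan)
    also have "\<dots> \<le> prob (space M - G) + prob (\<Union>i<n. ?E i)"
      by (rule measure_Un_le) (intro sets.finite_UN sets.compl_sets G Es finite_lessThan)+
    also have "prob (\<Union>i<n. ?E i) \<le> (\<Sum>i<n. prob (?E i))"
      using Es by (intro finite_measure_subadditive_finite) auto
    also have "prob (space M - G) + (\<Sum>i<n. prob (?E i)) = n * prob E"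
      using G by (simp add: prob_inv_into_funpow_vimage[OF E(1)] prob_compl)
    also have "\<dots> \<le> \<epsilon>" using E(3) n by (simp add: field_simps)
    finally show ?thesis by simp
  qed
  then show thesis using that J J_less by blast
qed

end

section \<open>The coding inequality\<close>

context ergodic_system
begin

text \<open>A point \<open>x\<close> is labelled through the most recent marked point \<open>y = T\<^sup>-\<^sup>i x\<close> with \<open>i < n\<close>: the cell
  of \<open>\<alpha>\<close> around \<open>y\<close> lies in an element of the \<open>n\<close>-fold join, whose \<open>i\<close>-th coordinate is an element of
  \<open>\<U>\<close> containing \<open>x\<close>.  Points with no mark among the last \<open>n\<close> times are labelled by an arbitrary
  measurable choice \<open>c\<close>.  The labelling is a block code of the observations \<open>mark Q X\<close> and \<open>mark Err c\<close>,
  whose entropies are controlled by \<open>exists_marker_small_entropy\<close> and by the smallness of \<open>Err\<close>.\<close>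
lemma h_plus_le_small_sets:
  fixes n :: nat
  assumes small: "\<And>\<delta>. \<delta> > 0 \<Longrightarrow> \<exists>A\<in>sets M. 0 < prob A \<and> prob A < \<delta>"
    and cover: "is_cover M \<U>" and n: "n > 0"
    and \<alpha>: "is_partition M \<alpha>" "finer \<alpha> (iterated_join M T \<U> n)"
  shows "h_plus M T \<U> \<le> (partition_entropy M \<alpha> + ln n + 1) / n"
proof (rule field_le_epsilon)
  fix \<delta> :: real assume \<delta>: "\<delta> > 0"
  let ?S = "inv_into (space M) T"
  (* The exceptional set will have measure at most s^2, so that the bound by a square root leaves at most
     s^2 + 2 s card U for the entropy of the choice c on it; s makes this at most \<delta>. *)
  define s where "s = min 1 (\<delta> / (1 + 2 * real (card \<U>)))"
  have s: "0 < s" "s \<le> 1" "s \<le> \<delta> / (1 + 2 * real (card \<U>))"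
    using \<delta> by (auto simp: s_def)
  define X where "X = cell_of \<alpha>"
  have X: "simple_function M X" unfolding X_def by (rule simple_function_cell_of_partition[OF \<alpha>(1)])
  have Ent_X: "Ent X = partition_entropy M \<alpha>"
    unfolding X_def
    by (rule partition_entropy_eq_entropy[symmetric, OF \<alpha>(1) simple_function_cell_of_partition[OF \<alpha>(1)]
          cell_of_partition_eq_iff[OF \<alpha>(1)]])
  obtain J :: "'a \<Rightarrow> nat" where J: "simple_function M J" "J ` space M \<subseteq> {..<n}"
    and clock: "\<And>j. j < n \<Longrightarrow> prob {x \<in> space M. \<forall>i<n. J ((?S ^^ i) x) \<noteq> j} \<le> s\<^sup>2"
    using exists_clock[OF small n, of "s\<^sup>2"] s by auto
  obtain j where j: "j < n" and Ent_mark: "Ent (mark (J -` {j} \<inter> space M) X) \<le> (Ent X + ln n + 1) / n"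
    using exists_marker_small_entropy[OF X J(1) n J(2)] by blast
  define Q where "Q = J -` {j} \<inter> space M"
  have Q: "Q \<in> sets M" unfolding Q_def by (rule simple_functionD(2)[OF J(1)])
  define Err where "Err = space M - (\<Union>i<n. (?S ^^ i) -` Q \<inter> space M)"
  have Err: "Err \<in> sets M"
    unfolding Err_def
    by (intro sets.compl_sets sets.finite_UN finite_lessThan measurable_sets[OF measurable_funpow[OF meas_inv] Q])
  have "Err = {x \<in> space M. \<forall>i<n. J ((?S ^^ i) x) \<noteq> j}"
    unfolding Err_def Q_def using inv_into_funpow_in_space by blast
  then have prob_Err: "prob Err \<le> s\<^sup>2" using clock[OF j] by simp
  obtain c where c: "simple_function M c" "\<And>x. x \<in> space M \<Longrightarrow> c x \<in> \<U> \<and> x \<in> c x"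
    using exists_simple_selection[OF cover] by blast
  have fin: "finite \<U>" using cover by (simp add: is_cover_def)
  have cU: "c ` space M \<subseteq> \<U>" using c(2) by blast
  have g: "simple_function M (mark Q X)"
    by (rule entropy_mark_le(1)[OF X simple_functionD(1)[OF X] subset_refl Q])
  have e: "simple_function M (mark Err c)"
    by (rule entropy_mark_le(1)[OF c(1) fin cU Err])
  have "Ent (mark Err c) \<le> prob Err + (\<Sum>V\<in>\<U>. neg_xlnx (prob (Err \<inter> c -` {V})))"
    by (rule entropy_mark_le(2)[OF c(1) fin cU Err])
  also have "\<dots> \<le> s\<^sup>2 + (\<Sum>V\<in>\<U>. 2 * s)"
  proof (intro add_mono prob_Err sum_mono)
    fix V
    have "prob (Err \<inter> c -` {V}) \<le> s\<^sup>2"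
      using finite_measure_mono[OF _ Err, of "Err \<inter> c -` {V}"] prob_Err by auto
    then have "sqrt (prob (Err \<inter> c -` {V})) \<le> s" using s by (intro real_le_lsqrt) auto
    then show "neg_xlnx (prob (Err \<inter> c -` {V})) \<le> 2 * s"
      using neg_xlnx_le_sqrt[of "prob (Err \<inter> c -` {V})"] by simp
  qed
  also have "\<dots> \<le> s * (1 + 2 * real (card \<U>))"
    using s by (simp add: power2_eq_square algebra_simps mult_left_le)
  also have "\<dots> \<le> \<delta>"
    using s(3) by (simp add: pos_le_divide_eq add_pos_nonneg)
  finally have Ent_Err: "Ent (mark Err c) \<le> \<delta>" .

  (* X y is the singleton of the cell of y, hence the union. *)
  define label where "label W i = (SOME V. V \<in> \<U> \<and> \<Union>W \<subseteq> (T ^^ i) -` V)" for W :: "'a set set" and i :: nat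
  have label: "label (X y) i \<in> \<U> \<and> (T ^^ i) y \<in> label (X y) i" if y: "y \<in> space M" and i: "i < n" for y i
  proof -
    obtain A where A: "A \<in> \<alpha>" "y \<in> A" using \<alpha>(1) y by (auto simp: is_partition_def is_cover_def)
    then obtain B where "B \<in> iterated_join M T \<U> n" "A \<subseteq> B" using \<alpha>(2) by (auto simp: finer_def)
    then obtain V where V: "V \<in> \<U>" "A \<subseteq> (T ^^ i) -` V"
      using iterated_join_elem_subset[OF _ i] by (meson order_trans)
    have XA: "\<Union>(X y) = A" using cell_of_partition[OF \<alpha>(1) A] by (simp add: X_def)
    have "label (X y) i \<in> \<U> \<and> \<Union>(X y) \<subseteq> (T ^^ i) -` label (X y) i"
      unfolding label_def by (rule someI[of _ V]) (use V XA in simp)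
    then show ?thesis using XA A by auto
  qed
  (* The list holds the observations at times 0, -1, ..., -(n-1); Err takes precedence, and outside Err the
     list has a marked entry. *)
  define decode where "decode v ws = (case v of Some V \<Rightarrow> V | None \<Rightarrow>
      (let i = LEAST i. i < n \<and> ws ! i \<noteq> None in label (the (ws ! i)) i))"
    for v :: "'a set option" and ws :: "'a set set option list"
  define Y where "Y x = decode (mark Err c x) (itinerary ?S (mark Q X) n x)" for x
  have Y: "simple_function M Y"
    unfolding Y_def[abs_def] by (rule simple_function_compose2[OF e simple_function_itinerary[OF meas_inv g]])
  have sel: "Y x \<in> \<U> \<and> x \<in> Y x" if x: "x \<in> space M" for x
  proof (cases "x \<in> Err")
    case True
    then show ?thesis using c(2)[OF x] by (simp add: Y_def decode_def mark_def)
  next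
    case False
    let ?P = "\<lambda>i. i < n \<and> itinerary ?S (mark Q X) n x ! i \<noteq> None"
    have P_iff: "?P i \<longleftrightarrow> i < n \<and> (?S ^^ i) x \<in> Q" for i
      by (auto simp: itinerary_nth mark_def split: if_splits)
    define i where "i = (LEAST i. ?P i)"
    obtain l where "?P l" using False x unfolding P_iff Err_def by blast
    then have "?P i" unfolding i_def by (rule LeastI)
    then have i: "i < n" "(?S ^^ i) x \<in> Q" using P_iff by blast+
    have "Y x = label (X ((?S ^^ i) x)) i"
      using False i unfolding Y_def decode_def i_def[symmetric] Let_def by (simp add: itinerary_nth mark_def)
    then show ?thesis
      using label[OF inv_into_funpow_in_space[OF x] i(1), of i] funpow_inv_into(1)[OF x, of i i] by simp
  qed
  let ?\<phi> = "\<lambda>x. (mark Q X x, mark Err c x)"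
  have Ent_\<phi>: "Ent ?\<phi> \<le> (partition_entropy M \<alpha> + ln n + 1) / n + \<delta>"
  proof -
    have "Ent ?\<phi> \<le> Ent (mark Q X) + Ent (mark Err c)"
      by (rule entropy_le_add_of_determines[OF g e]) simp
    then show ?thesis using Ent_mark Ent_Err by (simp add: Q_def Ent_X)
  qed
  show "h_plus M T \<U> \<le> (partition_entropy M \<alpha> + ln n + 1) / n + \<delta>"
  proof (rule h_plus_le_of_selection[OF cover Y sel])
    fix m
    have "Ent (itinerary T Y m) \<le> real (m + n) * Ent ?\<phi>"
    proof (rule entropy_itinerary_block_code_le[OF simple_function_Pair[OF g e] Y])
      fix x y assume xy: "x \<in> space M" "y \<in> space M" and eq: "\<forall>l\<le>n. ?\<phi> ((T ^^ l) x) = ?\<phi> ((T ^^ l) y)"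
      have "itinerary ?S (mark Q X) n ((T ^^ n) x) = itinerary ?S (mark Q X) n ((T ^^ n) y)"
        unfolding itinerary_eq_iff
        using eq funpow_inv_into(2)[OF xy(1), of _ n] funpow_inv_into(2)[OF xy(2), of _ n] by simp
      moreover have "mark Err c ((T ^^ n) x) = mark Err c ((T ^^ n) y)" using eq by simp
      ultimately show "Y ((T ^^ n) x) = Y ((T ^^ n) y)" by (simp add: Y_def)
    qed
    also have "\<dots> \<le> real (m + n) * ((partition_entropy M \<alpha> + ln n + 1) / n + \<delta>)"
      using Ent_\<phi> by (rule mult_left_mono) simp
    finally show "Ent (itinerary T Y m) \<le> real (m + n) * ((partition_entropy M \<alpha> + ln n + 1) / n + \<delta>)" .
  qed
qed

lemma h_plus_le_partition_entropy:
  fixes n :: nat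
  assumes cover: "is_cover M \<U>" and n: "n > 0"
    and \<alpha>: "is_partition M \<alpha>" "finer \<alpha> (iterated_join M T \<U> n)"
  shows "h_plus M T \<U> \<le> (partition_entropy M \<alpha> + ln n + 1) / n"
proof (cases "\<forall>\<delta>>0. \<exists>A\<in>sets M. 0 < prob A \<and> prob A < \<delta>")
  case True
  then show ?thesis by (intro h_plus_le_small_sets[OF _ cover n \<alpha>]) blast
next
  case False
  then obtain \<delta> where "\<delta> > 0" and "\<And>A. A \<in> sets M \<Longrightarrow> prob A > 0 \<Longrightarrow> \<delta> \<le> prob A"
    by (meson not_le)
  then have "h_plus M T \<U> \<le> 0" using cover by (rule h_plus_le_0_of_no_small_sets)
  also have "0 \<le> (partition_entropy M \<alpha> + ln n + 1) / n"
    using n partition_entropy_nonneg[OF \<alpha>(1)] by simp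
  finally show ?thesis .
qed

lemma h_plus_le_cover_entropy:
  fixes n :: nat
  assumes cover: "is_cover M \<U>" and n: "n > 0"
  shows "h_plus M T \<U> \<le> (cover_entropy M (iterated_join M T \<U> n) + ln n + 1) / n"
proof -
  obtain \<alpha> where "is_partition M \<alpha>" "finer \<alpha> (iterated_join M T \<U> n)"
    using exists_finer_partition[OF is_cover_iterated_join[OF cover meas]] by blast
  then have "n * h_plus M T \<U> - ln n - 1 \<le> cover_entropy M (iterated_join M T \<U> n)"
    unfolding cover_entropy_def
    using h_plus_le_partition_entropy[OF cover n] n
    by (intro cInf_greatest) (auto simp: field_simps)
  then show ?thesis using n by (simp add: field_simps)
qed

section \<open>Equality of the two entropies\<close>

theorem cover_entropy_average_tendsto:
  assumes cover: "is_cover M \<U>"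
  shows "(\<lambda>n. cover_entropy M (iterated_join M T \<U> n) / real n) \<longlonglongrightarrow> h_plus M T \<U>"
proof (rule order_tendstoI)
  fix y assume y: "y < h_plus M T \<U>"
  have "(\<lambda>n. (ln (real n) + 1) / real n) \<longlonglongrightarrow> 0" by real_asymp
  then have "\<forall>\<^sub>F n in sequentially. (ln (real n) + 1) / real n < h_plus M T \<U> - y"
    by (rule order_tendstoD) (use y in simp)
  then show "\<forall>\<^sub>F n in sequentially. y < cover_entropy M (iterated_join M T \<U> n) / real n"
    using eventually_gt_at_top[of 0]
  proof eventually_elim
    case (elim n)
    then show ?case using h_plus_le_cover_entropy[OF cover, of n] by (simp add: add_divide_distrib)
  qed
next
  fix y assume y: "h_plus M T \<U> < y"
  obtain \<alpha>' where "is_partition M \<alpha>'" "finer \<alpha>' \<U>" using exists_finer_partition[OF cover] by blast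
  then obtain \<alpha> where \<alpha>: "is_partition M \<alpha>" "finer \<alpha> \<U>" "dynamical_entropy M T \<alpha> < y"
    using y unfolding h_plus_def
    using cInf_lessD[of "{dynamical_entropy M T \<alpha> |\<alpha>. is_partition M \<alpha> \<and> finer \<alpha> \<U>}" y] by blast
  have le: "cover_entropy M (iterated_join M T \<U> n) / real n \<le> partition_entropy M (iterated_join M T \<alpha> n) / real n" for n
    by (intro divide_right_mono cover_entropy_le_partition_entropy is_partition_iterated_join finer_iterated_join \<alpha> meas) simp
  have "\<forall>\<^sub>F n in sequentially. partition_entropy M (iterated_join M T \<alpha> n) / real n < y"
    using partition_entropy_average_tendsto[OF \<alpha>(1)] \<alpha>(3) by (rule order_tendstoD)
  then show "\<forall>\<^sub>F n in sequentially. cover_entropy M (iterated_join M T \<U> n) / real n < y"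
    by eventually_elim (rule le_less_trans[OF le])
qed

end

theorem theorem4p5:
  fixes M :: "'a measure" and T :: "'a \<Rightarrow> 'a" and \<U> :: "'a set set"
  assumes "ergodic_system M T"
    and "is_cover M \<U>"
  shows "h_plus M T \<U> = h_minus M T \<U>"
proof -
  interpret ergodic_system M T by fact
  show ?thesis
    unfolding h_minus_def using cover_entropy_average_tendsto[OF assms(2)] by (simp add: limI)
qed

end
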